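(* Consider a system $(F,L,P,\gamma)$ with transfer function $S$ (as defined in the context), and let $1\le k'\le k$. The efficiency of a minimum sum-rate $(k,k')$ stabilizing code based on independent encodings is $$\eta=\frac{\log_2\!\big(1+k(k')^{-1}\|S-1\|^2\big)}{k\,\log_2\!\big(1+(k')^{-1}\|S-1\|^2\big)},$$ and the code is asymptotically efficient in the sense that $$\lim_{\|S-1\|^2\to0}\eta=1 .$$
   Context: System. $P$ is an open-loop unstable discrete-time LTI plant with $\begin{bmatrix} e \\ y \end{bmatrix}=\begin{bmatrix} P_{11} & P_{12} \\ P_{21} & P_{22} \end{bmatrix}\begin{bmatrix} d \\ u \end{bmatrix}$, with $u,y$ scalar and $d$ the Gaussian disturbance. The feedback loop is $u=Fw$, $w=v+q$, $v=L_wz^{-1}w+L_yy$, with $F$ and $L=[L_w,L_y]$ proper LTI filters making the loop internally stable and well posed, $z^{-1}$ the one-step delay, and $q$ additive white zero-mean coding noise of variance $\sigma_q^2$. $S=(1-L_wz^{-1}-P_{22}FL_y)^{-1}$, with $\|S-1\|>0$; $\|\cdot\|$ is the $H_2$ norm, $\|X\|^2=\frac1{2\pi}\int_{-\pi}^{\pi}\mathrm{tr}(X(e^{j\omega})^*X(e^{j\omega}))\,d\omega$. $\gamma=\sigma_v^2/\sigma_q^2$ where $\sigma_v^2$ is the stationary variance of $v$. $(F,L,P,\gamma)$ denotes such a system. Code. A $(k,k')$ code based on independent encodings consists of $k$ descriptions $y_i=v+q_i$, $i=1,\dots,k$, of the Gaussian signal $v$, where the $q_i$ are independent of $v$, mutually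 independent, zero-mean, with common variance $\sigma^2>0$. Using $\ell$ descriptions means using their average, whose signal-to-noise ratio (SNR) is the ratio of $\sigma_v^2$ to the variance of the averaged noise. The critical SNR for stability is $\|S-1\|^2$, and the code is $(k,k')$ stabilizing if any $k'$ descriptions reach it. The ideal sum-rate of the code is $\mathcal{R}_s=\frac k2\log_2(1+\sigma_v^2/\sigma^2)$; a minimum sum-rate $(k,k')$ stabilizing code is one for which this sum-rate equals the smallest value compatible with stability when using $k'$ descriptions, i.e. $\mathcal{R}_s=\frac k2\log_2\big(1+\|S-1\|^2/k'\big)$. Efficiency. The efficiency of a $(k,k')$ stabilizing code is $\eta=\dfrac{\log_2(1+\tilde\gamma)}{k\log_2(1+\hat\gamma)}$, where $\hat\gamma$ is the SNR when using any single description and $\tilde\gamma$ is the SNR when combining all $k$ descriptions. In the limit, $k$ and $k'$ are fixed. *)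

theory Defs
  imports "HOL-Probability.Probability" "HOL-Computational_Algebra.Formal_Power_Series"
begin

text \<open>
  A proper (i.e. causal) discrete-time LTI filter is identified with its transfer function,
  written as a formal power series in \<open>z\<^sup>-\<^sup>1\<close>: the \<open>n\<close>-th coefficient is the impulse response
  at time \<open>n\<close>, products are cascades, and \<open>fps_X\<close> is the one-step delay.  Signals start at
  time 0, so the response below is a finite sum even when the filter is unstable.
\<close>

definition filter_out :: "real fps \<Rightarrow> (nat \<Rightarrow> real) \<Rightarrow> nat \<Rightarrow> real" where
  "filter_out h x t = (\<Sum>i\<le>t. fps_nth h i * x (t - i))"

definition bibo_stable :: "real fps \<Rightarrow> bool" where
  "bibo_stable h \<longleftrightarrow> (\<forall>x. Bseq x \<longrightarrow> Bseq (filter_out h x))"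

text \<open>\<open>X(e\<^sup>j\<^sup>\<omega>)\<close>; since the series is in \<open>z\<^sup>-\<^sup>1\<close>, it is evaluated at \<open>e\<^sup>-\<^sup>j\<^sup>\<omega>\<close>.\<close>

definition freq_response :: "real fps \<Rightarrow> real \<Rightarrow> complex" where
  "freq_response X \<omega> = eval_fps (Abs_fps (\<lambda>n. complex_of_real (fps_nth X n))) (cis (- \<omega>))"

text \<open>The \<open>H\<^sub>2\<close> norm of a stable scalar \<open>X\<close>, for which \<open>tr(X\<^sup>*X)\<close> is the squared modulus.\<close>

definition h2_norm :: "real fps \<Rightarrow> real" where
  "h2_norm X = sqrt (1 / (2 * pi) * integral {-pi..pi} (\<lambda>\<omega>. (cmod (freq_response X \<omega>))\<^sup>2))"

record ('d::finite, 'e::finite) plant =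
  P11 :: "real fps ^ 'd ^ 'e"
  P12 :: "real fps ^ 'e"
  P21 :: "real fps ^ 'd"
  P22 :: "real fps"

record ('d::finite, 'e::finite) control_system =
  sysF :: "real fps"
  sysLw :: "real fps"
  sysLy :: "real fps"
  sysP :: "('d, 'e) plant"
  sysGamma :: real

definition open_loop_unstable :: "('d::finite, 'e::finite) plant \<Rightarrow> bool" where
  "open_loop_unstable P \<longleftrightarrow>
     \<not> ((\<forall>i j. bibo_stable (P11 P $ i $ j)) \<and> (\<forall>i. bibo_stable (P12 P $ i)) \<and>
        (\<forall>j. bibo_stable (P21 P $ j)) \<and> bibo_stable (P22 P))"

definition return_difference :: "('d::finite, 'e::finite) control_system \<Rightarrow> real fps" where
  "return_difference s =
     1 - sysLw s * fps_X - P22 (sysP s) * sysF s * sysLy s"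

definition well_posed :: "('d::finite, 'e::finite) control_system \<Rightarrow> bool" where
  "well_posed s \<longleftrightarrow> fps_nth (return_difference s) 0 \<noteq> 0"

definition sysS :: "('d::finite, 'e::finite) control_system \<Rightarrow> real fps" where
  "sysS s = inverse (return_difference s)"

text \<open>
  The loop equations, with extra signals \<open>ru\<close>, \<open>ry\<close>, \<open>rx\<close> added at the outputs of \<open>F\<close>, of the
  plant and of the delay.  They vanish in the actual loop and serve to express internal
  stability; together with \<open>d\<close> and \<open>q\<close> they excite the input of every block.
\<close>

definition loop_equations ::
  "('d::finite, 'e::finite) control_system \<Rightarrow> (nat \<Rightarrow> real ^ 'd) \<Rightarrow> (nat \<Rightarrow> real) \<Rightarrow>
   (nat \<Rightarrow> real) \<Rightarrow> (nat \<Rightarrow> real) \<Rightarrow> (nat \<Rightarrow> real) \<Rightarrow>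
   (nat \<Rightarrow> real ^ 'e) \<Rightarrow> (nat \<Rightarrow> real) \<Rightarrow> (nat \<Rightarrow> real) \<Rightarrow> (nat \<Rightarrow> real) \<Rightarrow> (nat \<Rightarrow> real) \<Rightarrow> bool"
where
  "loop_equations s d q ru ry rx e y u v w \<longleftrightarrow> (\<forall>t.
     (\<forall>i. e t $ i = (\<Sum>j\<in>UNIV. filter_out (P11 (sysP s) $ i $ j) (\<lambda>t. d t $ j) t)
                    + filter_out (P12 (sysP s) $ i) u t) \<and>
     y t = (\<Sum>j\<in>UNIV. filter_out (P21 (sysP s) $ j) (\<lambda>t. d t $ j) t)
           + filter_out (P22 (sysP s)) u t + ry t \<and>
     u t = filter_out (sysF s) w t + ru t \<and>
     w t = v t + q t \<and>
     v t = filter_out (sysLw s) (\<lambda>t. filter_out fps_X w t + rx t) t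
           + filter_out (sysLy s) y t)"

definition internally_stable :: "('d::finite, 'e::finite) control_system \<Rightarrow> bool" where
  "internally_stable s \<longleftrightarrow> (\<forall>d q ru ry rx e y u v w.
     loop_equations s d q ru ry rx e y u v w \<longrightarrow>
     Bseq d \<longrightarrow> Bseq q \<longrightarrow> Bseq ru \<longrightarrow> Bseq ry \<longrightarrow> Bseq rx \<longrightarrow>
     Bseq e \<and> Bseq y \<and> Bseq u \<and> Bseq v \<and> Bseq w)"

text \<open>Almost surely constant variables count as (degenerate) Gaussian.\<close>

definition gaussian_rv :: "'w measure \<Rightarrow> ('w \<Rightarrow> real) \<Rightarrow> bool" where
  "gaussian_rv M X \<longleftrightarrow> X \<in> borel_measurable M \<and>
     ((\<exists>\<mu> \<sigma>. 0 < \<sigma> \<and> distributed M lborel X (normal_density \<mu> \<sigma>)) \<or>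
      (\<exists>c. AE \<omega> in M. X \<omega> = c))"

definition gaussian_process ::
  "'w measure \<Rightarrow> (nat \<Rightarrow> 'w \<Rightarrow> 'a::euclidean_space) \<Rightarrow> bool" where
  "gaussian_process M X \<longleftrightarrow> (\<forall>t. X t \<in> borel_measurable M) \<and>
     (\<forall>n a. gaussian_rv M (\<lambda>\<omega>. \<Sum>t<n. a t \<bullet> X t \<omega>))"

definition var :: "'w measure \<Rightarrow> ('w \<Rightarrow> real) \<Rightarrow> real" where
  "var M X = prob_space.variance M X"

definition white_noise :: "'w measure \<Rightarrow> (nat \<Rightarrow> 'w \<Rightarrow> real) \<Rightarrow> real \<Rightarrow> bool" where
  "white_noise M q s2 \<longleftrightarrow>
     (\<forall>t. q t \<in> borel_measurable M \<and> integrable M (\<lambda>\<omega>. (q t \<omega>)\<^sup>2) \<and>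
          prob_space.expectation M (q t) = 0 \<and> var M (q t) = s2) \<and>
     (\<forall>t t'. t \<noteq> t' \<longrightarrow> prob_space.expectation M (\<lambda>\<omega>. q t \<omega> * q t' \<omega>) = 0)"

text \<open>
  Started at rest, the loop is only asymptotically stationary, so the stationary variance is
  the limit of the variances.  For \<open>v\<close> its existence is part of \<open>feedback_system\<close>; the
  averaged coding noises used below have constant variance.
\<close>

definition stationary_var :: "'w measure \<Rightarrow> (nat \<Rightarrow> 'w \<Rightarrow> real) \<Rightarrow> real" where
  "stationary_var M X = lim (\<lambda>t. var M (X t))"

record ('w, 'd::finite, 'e::finite) loop_signals =
  prob :: "'w measure"
  sig_d :: "nat \<Rightarrow> 'w \<Rightarrow> real ^ 'd"
  sig_q :: "nat \<Rightarrow> 'w \<Rightarrow> real"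
  sig_e :: "nat \<Rightarrow> 'w \<Rightarrow> real ^ 'e"
  sig_y :: "nat \<Rightarrow> 'w \<Rightarrow> real"
  sig_u :: "nat \<Rightarrow> 'w \<Rightarrow> real"
  sig_v :: "nat \<Rightarrow> 'w \<Rightarrow> real"
  sig_w :: "nat \<Rightarrow> 'w \<Rightarrow> real"

abbreviation sigma_v2 :: "('w, 'd::finite, 'e::finite) loop_signals \<Rightarrow> real" where
  "sigma_v2 g \<equiv> stationary_var (prob g) (sig_v g)"

definition feedback_system ::
  "('d::finite, 'e::finite) control_system \<Rightarrow> ('w, 'd, 'e) loop_signals \<Rightarrow> bool" where
  "feedback_system s g \<longleftrightarrow>
     open_loop_unstable (sysP s) \<and> well_posed s \<and> internally_stable s \<and>
     h2_norm (sysS s - 1) > 0 \<and>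
     prob_space (prob g) \<and>
     gaussian_process (prob g) (sig_d g) \<and>
     (\<forall>t. sig_e g t \<in> borel_measurable (prob g) \<and> sig_y g t \<in> borel_measurable (prob g) \<and>
          sig_u g t \<in> borel_measurable (prob g) \<and> sig_v g t \<in> borel_measurable (prob g) \<and>
          sig_w g t \<in> borel_measurable (prob g)) \<and>
     (\<forall>\<omega>\<in>space (prob g).
        loop_equations s (\<lambda>t. sig_d g t \<omega>) (\<lambda>t. sig_q g t \<omega>) (\<lambda>_. 0) (\<lambda>_. 0) (\<lambda>_. 0)
          (\<lambda>t. sig_e g t \<omega>) (\<lambda>t. sig_y g t \<omega>) (\<lambda>t. sig_u g t \<omega>)
          (\<lambda>t. sig_v g t \<omega>) (\<lambda>t. sig_w g t \<omega>)) \<and>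
     convergent (\<lambda>t. var (prob g) (sig_v g t)) \<and>
     (\<exists>\<sigma>q2 > 0. white_noise (prob g) (sig_q g) \<sigma>q2 \<and> sysGamma s = sigma_v2 g / \<sigma>q2)"

text \<open>
  \<open>noise c i t\<close> is the noise \<open>q\<^sub>i\<close> of description \<open>i \<in> {1..k}\<close> at time \<open>t\<close>.  Independence is
  required at each time instant: across time, \<open>v\<close> may depend on past noise through the loop.
\<close>

record 'w code =
  noise :: "nat \<Rightarrow> nat \<Rightarrow> 'w \<Rightarrow> real"
  noise_var :: real

definition independent_encodings ::
  "('w, 'd::finite, 'e::finite) loop_signals \<Rightarrow> 'w code \<Rightarrow> nat \<Rightarrow> bool" where
  "independent_encodings g c k \<longleftrightarrow>
     gaussian_process (prob g) (sig_v g) \<and> noise_var c > 0 \<and>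
     (\<forall>t. prob_space.indep_vars (prob g) (\<lambda>_. borel)
            (\<lambda>i. if i = 0 then sig_v g t else noise c i t) {0..k}) \<and>
     (\<forall>i\<in>{1..k}. \<forall>t. integrable (prob g) (\<lambda>\<omega>. (noise c i t \<omega>)\<^sup>2) \<and>
        prob_space.expectation (prob g) (noise c i t) = 0 \<and>
        var (prob g) (noise c i t) = noise_var c)"

definition description ::
  "('w, 'd::finite, 'e::finite) loop_signals \<Rightarrow> 'w code \<Rightarrow> nat \<Rightarrow> nat \<Rightarrow> 'w \<Rightarrow> real" where
  "description g c i t \<omega> = sig_v g t \<omega> + noise c i t \<omega>"

definition avg_description ::
  "('w, 'd::finite, 'e::finite) loop_signals \<Rightarrow> 'w code \<Rightarrow> nat set \<Rightarrow> nat \<Rightarrow> 'w \<Rightarrow> real" where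
  "avg_description g c I t \<omega> = (\<Sum>i\<in>I. description g c i t \<omega>) / real (card I)"

definition snr ::
  "('w, 'd::finite, 'e::finite) loop_signals \<Rightarrow> 'w code \<Rightarrow> nat set \<Rightarrow> real" where
  "snr g c I = sigma_v2 g /
     stationary_var (prob g) (\<lambda>t \<omega>. avg_description g c I t \<omega> - sig_v g t \<omega>)"

definition critical_snr :: "('d::finite, 'e::finite) control_system \<Rightarrow> real" where
  "critical_snr s = (h2_norm (sysS s - 1))\<^sup>2"

definition stabilizing_code ::
  "('d::finite, 'e::finite) control_system \<Rightarrow> ('w, 'd, 'e) loop_signals \<Rightarrow> 'w code \<Rightarrow>
   nat \<Rightarrow> nat \<Rightarrow> bool" where
  "stabilizing_code s g c k k' \<longleftrightarrow>
     independent_encodings g c k \<and>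
     (\<forall>I. I \<subseteq> {1..k} \<and> card I = k' \<longrightarrow> snr g c I \<ge> critical_snr s)"

definition sum_rate ::
  "('w, 'd::finite, 'e::finite) loop_signals \<Rightarrow> 'w code \<Rightarrow> nat \<Rightarrow> real" where
  "sum_rate g c k = real k / 2 * log 2 (1 + sigma_v2 g / noise_var c)"

definition min_sum_rate_stabilizing_code ::
  "('d::finite, 'e::finite) control_system \<Rightarrow> ('w, 'd, 'e) loop_signals \<Rightarrow> 'w code \<Rightarrow>
   nat \<Rightarrow> nat \<Rightarrow> bool" where
  "min_sum_rate_stabilizing_code s g c k k' \<longleftrightarrow>
     stabilizing_code s g c k k' \<and>
     sum_rate g c k = real k / 2 * log 2 (1 + (h2_norm (sysS s - 1))\<^sup>2 / real k')"

text \<open>The argument \<open>i\<close> is the single description whose SNR enters the denominator.\<close>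

definition efficiency ::
  "('w, 'd::finite, 'e::finite) loop_signals \<Rightarrow> 'w code \<Rightarrow> nat \<Rightarrow> nat \<Rightarrow> real" where
  "efficiency g c k i =
     log 2 (1 + snr g c {1..k}) / (real k * log 2 (1 + snr g c {i}))"

end

theory Submission
  imports Defs "HOL-Real_Asymp.Real_Asymp"
begin

text \<open>
  Averaging \<open>n\<close> independent descriptions divides the noise variance by \<open>n\<close>, so it multiplies the
  single-description signal-to-noise ratio by \<open>n\<close>.  Since the ideal sum-rate is strictly increasing
  in that ratio, the minimum sum-rate forces it to be \<open>\<parallel>S - 1\<parallel>\<^sup>2 / k'\<close>; all \<open>k\<close> descriptions together
  then reach \<open>k\<close> times this value.  The limit follows from \<open>log\<^sub>2 (1 + x) \<sim> x / ln 2\<close> at \<open>0\<close>.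
\<close>

text \<open>Independence factors the mixed moment E[XY] into E[X] E[Y], which cancels the cross term
  of the squared mean. Square integrability of the sum is kept as a conclusion so that the result
  can be iterated.\<close>

lemma (in prob_space) variance_add_indep:
  fixes X Y :: "'a \<Rightarrow> real"
  assumes indep: "indep_var borel X borel Y"
    and X2: "integrable M (\<lambda>\<omega>. (X \<omega>)\<^sup>2)" and Y2: "integrable M (\<lambda>\<omega>. (Y \<omega>)\<^sup>2)"
  shows "integrable M (\<lambda>\<omega>. (X \<omega> + Y \<omega>)\<^sup>2)"
    and "variance (\<lambda>\<omega>. X \<omega> + Y \<omega>) = variance X + variance Y"
proof -
  have X: "integrable M X" and Y: "integrable M Y"
    using X2 Y2 indep_var_rv1[OF indep] indep_var_rv2[OF indep]
    by (auto intro: square_integrable_imp_integrable)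
  note XY = indep_var_integrable[OF indep X Y] indep_var_lebesgue_integral[OF indep X Y]
  have sq: "(\<lambda>\<omega>. (X \<omega> + Y \<omega>)\<^sup>2) = (\<lambda>\<omega>. (X \<omega>)\<^sup>2 + (Y \<omega>)\<^sup>2 + 2 * (X \<omega> * Y \<omega>))"
    by (simp add: power2_sum mult.assoc)
  show int: "integrable M (\<lambda>\<omega>. (X \<omega> + Y \<omega>)\<^sup>2)"
    unfolding sq using X2 Y2 XY(1) by simp
  have "expectation (\<lambda>\<omega>. (X \<omega> + Y \<omega>)\<^sup>2) =
      expectation (\<lambda>\<omega>. (X \<omega>)\<^sup>2) + expectation (\<lambda>\<omega>. (Y \<omega>)\<^sup>2) + 2 * (expectation X * expectation Y)"
    unfolding sq using X2 Y2 XY by simp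
  moreover have "expectation (\<lambda>\<omega>. X \<omega> + Y \<omega>) = expectation X + expectation Y"
    using X Y by simp
  ultimately show "variance (\<lambda>\<omega>. X \<omega> + Y \<omega>) = variance X + variance Y"
    using variance_eq[OF X X2] variance_eq[OF Y Y2] variance_eq[OF _ int] X Y
    by (simp add: power2_sum)
qed

text \<open>The two claims are proved jointly: adding one more term to the sum requires the partial
  sum to be square integrable already.\<close>

lemma (in prob_space) variance_sum_indep:
  fixes X :: "'i \<Rightarrow> 'a \<Rightarrow> real"
  assumes "finite I" and "indep_vars (\<lambda>_. borel) X I"
    and "\<And>i. i \<in> I \<Longrightarrow> integrable M (\<lambda>\<omega>. (X i \<omega>)\<^sup>2)"
  shows "integrable M (\<lambda>\<omega>. (\<Sum>i\<in>I. X i \<omega>)\<^sup>2) \<and>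
    variance (\<lambda>\<omega>. \<Sum>i\<in>I. X i \<omega>) = (\<Sum>i\<in>I. variance (X i))"
  using assms
proof (induction I rule: finite_induct)
  case empty
  then show ?case by simp
next
  case (insert a I)
  have indep: "indep_var borel (X a) borel (\<lambda>\<omega>. \<Sum>i\<in>I. X i \<omega>)"
    using insert by (intro indep_vars_sum)
  have "indep_vars (\<lambda>_. borel) X I"
    using insert.prems(1) by (rule indep_vars_subset) auto
  then have IH: "integrable M (\<lambda>\<omega>. (\<Sum>i\<in>I. X i \<omega>)\<^sup>2)"
      "variance (\<lambda>\<omega>. \<Sum>i\<in>I. X i \<omega>) = (\<Sum>i\<in>I. variance (X i))"
    using insert.IH insert.prems(2) by auto
  show ?case
    using variance_add_indep[OF indep insert.prems(2) IH(1)] IH(2) insert.hyps by simp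
qed

text \<open>Convergence matters because \<open>lim\<close> is unspecified on divergent sequences;
  given it, the bound passes to the limit from the variances.\<close>

lemma stationary_var_nonneg:
  assumes "convergent (\<lambda>t. var M (X t))"
  shows "0 \<le> stationary_var M X"
proof -
  have "(\<lambda>t. var M (X t)) \<longlonglongrightarrow> stationary_var M X"
    using assms unfolding stationary_var_def by (simp add: convergent_LIMSEQ_iff)
  then show ?thesis
    by (rule LIMSEQ_le_const) (simp add: var_def)
qed

lemma var_avg_noise:
  assumes "prob_space (prob g)" and ie: "independent_encodings g c k"
    and I: "I \<subseteq> {1..k}" "I \<noteq> {}"
  shows "var (prob g) (\<lambda>\<omega>. avg_description g c I t \<omega> - sig_v g t \<omega>) = noise_var c / real (card I)"
proof -
  interpret P: prob_space "prob g" by fact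
  have fin: "finite I"
    using I(1) finite_subset by blast
  then have n: "real (card I) > 0"
    using I(2) by (simp add: card_gt_0_iff)
  have "P.indep_vars (\<lambda>_. borel) (\<lambda>i. if i = 0 then sig_v g t else noise c i t) I"
    using ie I(1) unfolding independent_encodings_def
    by (intro P.indep_vars_subset[where I = "{0..k}" and J = I]) auto
  \<comment> \<open>Index 0 carries the signal; \<open>I\<close> lies in \<open>{1..k}\<close>, so
    only the noise branch of the conditional remains.\<close>
  then have indep: "P.indep_vars (\<lambda>_. borel) (\<lambda>i. noise c i t) I"
    using I(1) by (subst (asm) P.indep_vars_cong[where Y = "\<lambda>i. noise c i t", OF refl _ refl]) auto
  have sq: "integrable (prob g) (\<lambda>\<omega>. (noise c i t \<omega>)\<^sup>2)"
    and v: "P.variance (noise c i t) = noise_var c" if "i \<in> I" for i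
    using ie I(1) that unfolding independent_encodings_def var_def by auto
  have avg: "avg_description g c I t \<omega> - sig_v g t \<omega> = (\<Sum>i\<in>I. noise c i t \<omega>) / real (card I)" for \<omega>
    using n by (simp add: avg_description_def description_def sum.distrib field_simps)
  have "var (prob g) (\<lambda>\<omega>. avg_description g c I t \<omega> - sig_v g t \<omega>) =
      P.variance (\<lambda>\<omega>. \<Sum>i\<in>I. noise c i t \<omega>) / (real (card I))\<^sup>2"
    by (simp add: avg var_def power_divide flip: diff_divide_distrib)
  also have "\<dots> = (\<Sum>i\<in>I. P.variance (noise c i t)) / (real (card I))\<^sup>2"
    using P.variance_sum_indep[OF fin indep sq] by simp
  also have "\<dots> = real (card I) * noise_var c / (real (card I))\<^sup>2"
    by (simp add: v)
  also have "\<dots> = noise_var c / real (card I)"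
    using n by (simp add: power2_eq_square)
  finally show ?thesis .
qed

text \<open>The variance of the averaged noise does not depend on \<open>t\<close>, so its
  stationary value is that constant.\<close>

lemma snr_independent_encodings:
  assumes "prob_space (prob g)" "independent_encodings g c k" "I \<subseteq> {1..k}" "I \<noteq> {}"
  shows "snr g c I = real (card I) * (sigma_v2 g / noise_var c)"
  using var_avg_noise[OF assms] by (simp add: snr_def stationary_var_def)

lemma min_sum_rate_snr:
  assumes fs: "feedback_system s g" and code: "min_sum_rate_stabilizing_code s g c k k'"
    and "0 < k"
  shows "sigma_v2 g / noise_var c = (h2_norm (sysS s - 1))\<^sup>2 / real k'"
proof -
  have "0 < noise_var c"
    using code
    unfolding min_sum_rate_stabilizing_code_def stabilizing_code_def independent_encodings_def
    by blast
  moreover have "0 \<le> sigma_v2 g"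
    using fs unfolding feedback_system_def by (intro stationary_var_nonneg) blast
  ultimately have "0 \<le> sigma_v2 g / noise_var c"
    by simp
  moreover have "0 \<le> (h2_norm (sysS s - 1))\<^sup>2 / real k'"
    by simp
  moreover have "log 2 (1 + sigma_v2 g / noise_var c) = log 2 (1 + (h2_norm (sysS s - 1))\<^sup>2 / real k')"
    using code \<open>0 < k\<close> unfolding min_sum_rate_stabilizing_code_def sum_rate_def by simp
  \<comment> \<open>Both logarithms have arguments at least 1, where the logarithm is
    injective.\<close>
  ultimately show ?thesis
    by (simp add: log_def add_pos_nonneg)
qed

lemma efficiency_eq:
  assumes fs: "feedback_system s g" and code: "min_sum_rate_stabilizing_code s g c k k'"
    and i: "i \<in> {1..k}"
  shows "efficiency g c k i =
    log 2 (1 + real k * inverse (real k') * (h2_norm (sysS s - 1))\<^sup>2) /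
    (real k * log 2 (1 + inverse (real k') * (h2_norm (sysS s - 1))\<^sup>2))"
proof -
  have ps: "prob_space (prob g)"
    using fs unfolding feedback_system_def by blast
  have ie: "independent_encodings g c k"
    using code unfolding min_sum_rate_stabilizing_code_def stabilizing_code_def by blast
  have snr: "snr g c I = real (card I) * ((h2_norm (sysS s - 1))\<^sup>2 / real k')"
    if "I \<subseteq> {1..k}" "I \<noteq> {}" for I
    \<comment> \<open>The membership of \<open>i\<close> in \<open>{1..k}\<close> also supplies
      \<open>0 < k\<close>.\<close>
    using snr_independent_encodings[OF ps ie that] min_sum_rate_snr[OF fs code] i
    by (simp flip: times_divide_eq_right)
  have "snr g c {1..k} = real k * ((h2_norm (sysS s - 1))\<^sup>2 / real k')"
    using i by (subst snr) auto
  moreover have "snr g c {i} = (h2_norm (sysS s - 1))\<^sup>2 / real k'"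
    using i by (subst snr) auto
  ultimately show ?thesis
    by (simp add: efficiency_def divide_inverse mult_ac)
qed

text \<open>Numerator and denominator share the leading term a b x / ln 2, and the factor 1 / ln 2
  cancels.\<close>

lemma tendsto_log_ratio_at_right_0:
  fixes a b :: real
  assumes "0 < a" "0 < b"
  shows "((\<lambda>x. log 2 (1 + a * b * x) / (a * log 2 (1 + b * x))) \<longlongrightarrow> 1) (at_right 0)"
proof -
  have "((\<lambda>x. ln (1 + a * b * x) / (a * ln (1 + b * x))) \<longlongrightarrow> 1) (at_right 0)"
    using assms by (real_asymp simp: field_simps)
  then show ?thesis
    by (simp add: log_def)
qed

theorem lemma3:
  fixes k k' :: nat
  assumes "1 \<le> k'" and "k' \<le> k"
  shows "(\<forall>(s :: ('d::finite, 'e::finite) control_system) (g :: ('w, 'd, 'e) loop_signals)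
            (c :: 'w code). \<forall>i\<in>{1..k}.
            feedback_system s g \<longrightarrow> min_sum_rate_stabilizing_code s g c k k' \<longrightarrow>
            efficiency g c k i =
              log 2 (1 + real k * inverse (real k') * (h2_norm (sysS s - 1))\<^sup>2) /
              (real k * log 2 (1 + inverse (real k') * (h2_norm (sysS s - 1))\<^sup>2)))
       \<and> (\<forall>\<epsilon>>0. \<exists>\<delta>>0. \<forall>(s :: ('d, 'e) control_system) (g :: ('w, 'd, 'e) loop_signals)
            (c :: 'w code). \<forall>i\<in>{1..k}.
            feedback_system s g \<longrightarrow> min_sum_rate_stabilizing_code s g c k k' \<longrightarrow>
            (h2_norm (sysS s - 1))\<^sup>2 < \<delta> \<longrightarrow> \<bar>efficiency g c k i - 1\<bar> < \<epsilon>)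
       \<and> ((\<lambda>x. log 2 (1 + real k * inverse (real k') * x) /
                (real k * log 2 (1 + inverse (real k') * x))) \<longlongrightarrow> 1) (at_right 0)"
proof -
  define \<eta> where "\<eta> x = log 2 (1 + real k * inverse (real k') * x) /
      (real k * log 2 (1 + inverse (real k') * x))" for x
  have lim: "(\<eta> \<longlongrightarrow> 1) (at_right 0)"
    unfolding \<eta>_def using assms by (intro tendsto_log_ratio_at_right_0) auto
  \<comment> \<open>The efficiency depends on system, signals, code and description only through one
    real number, so a \<delta> found for \<eta> serves all of them uniformly.\<close>
  have eff: "efficiency g c k i = \<eta> ((h2_norm (sysS s - 1))\<^sup>2)"
    if "i \<in> {1..k}" "feedback_system s g" "min_sum_rate_stabilizing_code s g c k k'"
    for s :: "('d, 'e) control_system" and g :: "('w, 'd, 'e) loop_signals" and c i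
    unfolding \<eta>_def by (rule efficiency_eq) (use that in auto)
  have "\<exists>\<delta>>0. \<forall>(s :: ('d, 'e) control_system) (g :: ('w, 'd, 'e) loop_signals) (c :: 'w code).
      \<forall>i\<in>{1..k}. feedback_system s g \<longrightarrow> min_sum_rate_stabilizing_code s g c k k' \<longrightarrow>
        (h2_norm (sysS s - 1))\<^sup>2 < \<delta> \<longrightarrow> \<bar>efficiency g c k i - 1\<bar> < \<epsilon>" if "\<epsilon> > 0" for \<epsilon>
  proof -
    have "eventually (\<lambda>x. \<bar>\<eta> x - 1\<bar> < \<epsilon>) (at_right 0)"
      using tendstoD[OF lim that] by (simp add: dist_real_def)
    then obtain \<delta> where "\<delta> > 0" and \<delta>: "\<And>x. 0 < x \<Longrightarrow> x < \<delta> \<Longrightarrow> \<bar>\<eta> x - 1\<bar> < \<epsilon>"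
      by (auto simp: eventually_at_right_field)
    have "\<bar>efficiency g c k i - 1\<bar> < \<epsilon>"
      if "i \<in> {1..k}" "feedback_system s g" "min_sum_rate_stabilizing_code s g c k k'"
        "(h2_norm (sysS s - 1))\<^sup>2 < \<delta>"
      for s :: "('d, 'e) control_system" and g :: "('w, 'd, 'e) loop_signals" and c i
    proof -
      \<comment> \<open>The one-sided limit says nothing at 0, where \<eta> takes the value 0
        because division by zero yields 0; the norm must be strictly positive.\<close>
      have "0 < h2_norm (sysS s - 1)"
        using that(2) unfolding feedback_system_def by blast
      then show ?thesis
        using eff[OF that(1-3)] \<delta>[OF _ that(4)] by simp
    qed
    then show ?thesis
      using \<open>\<delta> > 0\<close> by blast
  qed
  then show ?thesis
    using eff lim unfolding \<eta>_def by blast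
qed

end
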